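(* Let $f \in S_{\sigma}(\varphi)$. Then for every $\varepsilon > 0$ and every $m \in \mathbb{Z}_+$ there exists a constant $c_{\varepsilon,m} > 0$ such that for all $n \in \mathbb{Z}_+$ and all $x \in \mathbb{R}$ $$|x^m f^{(n)}(x)| \le c_{\varepsilon,m}\, n!\, (\sigma+\varepsilon)^n e^{-\psi^*(n)}.$$
   Context: $\mathbb{Z}_+ = \{0,1,2,\dots\}$, and $0^0 = 1$. Fix a real number $\sigma > 0$ and a nonnegative nondecreasing continuous function $\varphi$ on $[0,\infty)$ such that: (1) $\lim_{x\to+\infty} \varphi(x)/x = +\infty$; (2) for every $h > 1$ there exists $K_h > 0$ such that $2\varphi(x) \le \varphi(hx) + K_h$ for all $x \in [0,\infty)$; (3) the function $x \mapsto \varphi(e^x)$ is convex on $[0,\infty)$. For $\varepsilon > 0$ and $k \in \mathbb{Z}_+$, $S_{\varepsilon,k}(\varphi)$ is the set of entire functions $f$ on $\mathbb{C}$ with $$p_{\varepsilon,k}(f) = \sup_{z\in\mathbb{C}} \frac{|f(z)|(1+|z|)^k}{e^{\varphi((\sigma+\varepsilon)|\mathrm{Im}\, z|)}} < \infty,$$ and $S_{\sigma}(\varphi) = \bigcap_{\varepsilon>0,\,k\in\mathbb{Z}_+} S_{\varepsilon,k}(\varphi)$. Let $\psi(x) = \varphi(e^x)$. Its Young conjugate is $\psi^*(x) = \sup_{y>0}(xy - \psi(y))$, $x \ge 0$ (only $y>0$ is used). *)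

theory Defs
  imports "HOL-Complex_Analysis.Complex_Analysis"
begin

text \<open>The supremum is taken in the extended reals, so that finiteness is a genuine condition.\<close>

definition p_seminorm ::
    "real \<Rightarrow> (real \<Rightarrow> real) \<Rightarrow> real \<Rightarrow> nat \<Rightarrow> (complex \<Rightarrow> complex) \<Rightarrow> ereal" where
  "p_seminorm \<sigma> \<phi> \<epsilon> k f =
     (SUP z. ereal (cmod (f z) * (1 + cmod z) ^ k / exp (\<phi> ((\<sigma> + \<epsilon>) * \<bar>Im z\<bar>))))"

definition S_space_step ::
    "real \<Rightarrow> (real \<Rightarrow> real) \<Rightarrow> real \<Rightarrow> nat \<Rightarrow> (complex \<Rightarrow> complex) set" where
  "S_space_step \<sigma> \<phi> \<epsilon> k = {f. f holomorphic_on UNIV \<and> p_seminorm \<sigma> \<phi> \<epsilon> k f < \<infinity>}"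

definition S_space :: "real \<Rightarrow> (real \<Rightarrow> real) \<Rightarrow> (complex \<Rightarrow> complex) set" where
  "S_space \<sigma> \<phi> = (\<Inter>\<epsilon>\<in>{0<..}. \<Inter>k. S_space_step \<sigma> \<phi> \<epsilon> k)"

text \<open>
  The supremum in the Young conjugate is a supremum of reals. The lemma \<open>bdd_above_young\<close>
  shows that it is finite for the functions \<open>\<psi>(x) = \<phi>(exp x)\<close> it is applied to.
\<close>

definition young_conj :: "(real \<Rightarrow> real) \<Rightarrow> real \<Rightarrow> real" where
  "young_conj \<psi> x = (SUP y\<in>{0<..}. x * y - \<psi> y)"

lemma bdd_above_young:
  fixes \<phi> :: "real \<Rightarrow> real"
  assumes nonneg: "\<And>x. 0 \<le> x \<Longrightarrow> 0 \<le> \<phi> x"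
    and lim: "filterlim (\<lambda>x. \<phi> x / x) at_top at_top"
    and x: "0 \<le> x"
  shows "bdd_above ((\<lambda>y. x * y - \<phi> (exp y)) ` {0<..})"
proof -
  have "eventually (\<lambda>t. x \<le> \<phi> t / t) at_top"
    using lim by (simp add: filterlim_at_top)
  then obtain T where T: "\<And>t. T \<le> t \<Longrightarrow> x \<le> \<phi> t / t"
    by (auto simp: eventually_at_top_linorder)
  have "x * y - \<phi> (exp y) \<le> x * \<bar>T\<bar>" if "y > 0" for y
  proof (cases "T \<le> exp y")
    case True
    then have "x * exp y \<le> \<phi> (exp y)"
      using T[OF True] by (simp add: pos_le_divide_eq)
    moreover have "x * y \<le> x * exp y"
      using x exp_ge_add_one_self[of y] by (intro mult_left_mono) linarith+
    moreover have "0 \<le> x * \<bar>T\<bar>" using x by simp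
    ultimately show ?thesis by linarith
  next
    case False
    then have "y \<le> \<bar>T\<bar>"
      using exp_ge_add_one_self[of y] by linarith
    then have "x * y \<le> x * \<bar>T\<bar>"
      using x by (intro mult_left_mono)
    moreover have "0 \<le> \<phi> (exp y)" by (rule nonneg) simp
    ultimately show ?thesis by linarith
  qed
  then show ?thesis by (intro bdd_aboveI2) auto
qed

end

theory Submission
  imports Defs
begin

text \<open>
  On the circle of radius \<open>R\<close> about a real point \<open>x\<close> the imaginary part is at most \<open>R\<close> in absolute
  value, and \<open>\<bar>x\<bar>\<close> exceeds \<open>\<bar>z\<bar>\<close> by at most \<open>R\<close>. As \<open>\<phi>\<close> is nondecreasing, Cauchy's estimate on this
  circle therefore gives, for \<open>a = \<sigma> + \<epsilon>/2\<close> and a bound \<open>P\<close> of \<open>p_seminorm \<sigma> \<phi> (\<epsilon>/2) m f\<close>,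
  \<open>\<bar>x^m f^(n)(x)\<bar> \<le> P n! (1 + R)^m exp (\<phi> (a R)) / R^n\<close>. The polynomial factor \<open>(1 + R)^m\<close> is
  dominated by \<open>exp (\<phi> (a R))\<close> because \<open>\<phi>\<close> is superlinear, and condition (2) then absorbs the
  resulting \<open>exp (2 \<phi> (a R))\<close> into \<open>exp (\<phi> (b R))\<close> at the price of passing from \<open>a\<close> to the larger
  number \<open>b = \<sigma> + \<epsilon>\<close>.

  The constant does not depend on \<open>R\<close>, so \<open>R\<close> may be chosen for each \<open>n\<close>. With \<open>b R = exp y\<close> the
  bound reads \<open>n! b^n exp (-(n y - \<phi> (exp y)))\<close>, and optimizing over \<open>y > 0\<close> produces the Young
  conjugate in the exponent.
\<close>

lemma S_space_weighted_bound:
  assumes "f \<in> S_space \<sigma> \<phi>" "\<epsilon> > 0"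
  obtains P where "P > 0"
    "\<And>z. cmod (f z) * (1 + cmod z) ^ k \<le> P * exp (\<phi> ((\<sigma> + \<epsilon>) * \<bar>Im z\<bar>))"
proof -
  define g where "g z = cmod (f z) * (1 + cmod z) ^ k / exp (\<phi> ((\<sigma> + \<epsilon>) * \<bar>Im z\<bar>))" for z
  have "p_seminorm \<sigma> \<phi> \<epsilon> k f < \<infinity>"
    using assms by (auto simp: S_space_def S_space_step_def)
  then have fin: "(SUP z. ereal (g z)) < \<infinity>"
    by (simp add: p_seminorm_def g_def)
  obtain P where P: "\<And>z. ereal (g z) \<le> ereal P"
  proof (cases "SUP z. ereal (g z)")
    case (real r)
    then show ?thesis using that[of r] by (metis SUP_upper UNIV_I)
  next
    case PInf
    then show ?thesis using fin by simp
  next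
    case MInf
    then show ?thesis using SUP_upper[of 0 UNIV "\<lambda>z. ereal (g z)"] by simp
  qed
  show ?thesis
  proof (rule that)
    show "max 1 P > 0" by simp
    fix z
    have "g z \<le> max 1 P" using P[of z] by simp
    then show "cmod (f z) * (1 + cmod z) ^ k \<le> max 1 P * exp (\<phi> ((\<sigma> + \<epsilon>) * \<bar>Im z\<bar>))"
      by (simp add: g_def divide_le_eq)
  qed
qed

text \<open>
  Moving the factor \<open>x^m\<close> inside Cauchy's estimate costs a factor \<open>(1 + R)^m\<close>, since
  \<open>\<bar>x\<bar> \<le> \<bar>z\<bar> + R \<le> (1 + \<bar>z\<bar>) (1 + R)\<close> on the circle.
\<close>

lemma weighted_Cauchy_estimate:
  fixes x :: real and f :: "complex \<Rightarrow> complex"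
  assumes hol: "f holomorphic_on UNIV" and R: "R > 0"
    and B: "\<And>z. \<bar>Im z\<bar> \<le> R \<Longrightarrow> cmod (f z) * (1 + cmod z) ^ m \<le> B"
  shows "cmod (of_real x ^ m * (deriv ^^ n) f (of_real x)) \<le> fact n * ((1 + R) ^ m * B) / R ^ n"
proof -
  define g where "g z = of_real x ^ m * f z" for z
  have circle: "cmod (g z) \<le> (1 + R) ^ m * B" if z: "cmod (of_real x - z) = R" for z
  proof -
    have "\<bar>Im z\<bar> \<le> R"
      using abs_Im_le_cmod[of "of_real x - z"] z by simp
    have "\<bar>x\<bar> \<le> cmod z + R"
      using norm_triangle_sub[of "complex_of_real x" z] z by simp
    also have "\<dots> \<le> (1 + R) * (1 + cmod z)"
      using R by (simp add: algebra_simps)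
    finally have "\<bar>x\<bar> ^ m \<le> ((1 + R) * (1 + cmod z)) ^ m"
      by (intro power_mono) auto
    then have "cmod (g z) \<le> ((1 + R) * (1 + cmod z)) ^ m * cmod (f z)"
      by (simp add: g_def norm_mult norm_power mult_right_mono)
    also have "\<dots> = (1 + R) ^ m * (cmod (f z) * (1 + cmod z) ^ m)"
      by (simp add: power_mult_distrib)
    also have "\<dots> \<le> (1 + R) ^ m * B"
      using R B[OF \<open>\<bar>Im z\<bar> \<le> R\<close>] by (intro mult_left_mono) auto
    finally show ?thesis .
  qed
  have holg: "g holomorphic_on S" for S
    unfolding g_def by (intro holomorphic_intros holomorphic_on_subset[OF hol]) auto
  have "(deriv ^^ n) g (of_real x) = of_real x ^ m * (deriv ^^ n) f (of_real x)"
    unfolding g_def by (rule higher_deriv_cmult[OF hol]) auto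
  moreover have "cmod ((deriv ^^ n) g (of_real x)) \<le> fact n * ((1 + R) ^ m * B) / R ^ n"
    using circle R
    by (intro Cauchy_inequality holg holomorphic_on_imp_continuous_on)
       (auto simp: dist_norm)
  ultimately show ?thesis by simp
qed

text \<open>
  Superlinearity lets \<open>\<phi> (a R)\<close> dominate \<open>m R \<ge> m ln (1 + R)\<close> up to a constant, and the second copy
  of \<open>\<phi> (a R)\<close> so produced is paid for by the doubling condition with \<open>h = b / a\<close>.
\<close>

lemma superlinear_doubling_absorbs_power:
  fixes \<phi> :: "real \<Rightarrow> real"
  assumes nonneg: "\<And>x. 0 \<le> x \<Longrightarrow> 0 \<le> \<phi> x"
    and lim: "filterlim (\<lambda>x. \<phi> x / x) at_top at_top"
    and doubling: "\<And>h. h > 1 \<Longrightarrow> \<exists>K>0. \<forall>x\<ge>0. 2 * \<phi> x \<le> \<phi> (h * x) + K"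
    and ab: "0 < a" "a < b"
  obtains C where "C > 0" "\<And>R. 0 \<le> R \<Longrightarrow> (1 + R) ^ m * exp (\<phi> (a * R)) \<le> C * exp (\<phi> (b * R))"
proof -
  have "eventually (\<lambda>t. real m / a \<le> \<phi> t / t) at_top"
    using lim by (simp add: filterlim_at_top)
  then obtain T where T: "\<And>t. T \<le> t \<Longrightarrow> real m / a \<le> \<phi> t / t"
    by (auto simp: eventually_at_top_linorder)
  have cancel: "m / a * (a * R) = m * R" for R :: real
    using ab by simp
  have linear: "m * R \<le> \<phi> (a * R) + m / a * \<bar>T\<bar>" if R: "R \<ge> 0" for R :: real
  proof (cases "T \<le> a * R \<and> R > 0")
    case True
    then have "m / a * (a * R) \<le> \<phi> (a * R)"
      using T[of "a * R"] ab by (simp add: pos_le_divide_eq)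
    moreover have "0 \<le> m / a * \<bar>T\<bar>" using ab by simp
    ultimately show ?thesis using cancel[of R] by linarith
  next
    case False
    then have "a * R \<le> \<bar>T\<bar>" using R by auto
    then have "m / a * (a * R) \<le> m / a * \<bar>T\<bar>"
      using ab by (intro mult_left_mono) auto
    moreover have "0 \<le> \<phi> (a * R)" using nonneg ab R by simp
    ultimately show ?thesis using cancel[of R] by linarith
  qed
  have "b / a > 1" using ab by simp
  from doubling[OF this] obtain K where K: "\<And>x. x \<ge> 0 \<Longrightarrow> 2 * \<phi> x \<le> \<phi> (b / a * x) + K"
    by blast
  show ?thesis
  proof (rule that)
    show "exp (m / a * \<bar>T\<bar> + K) > 0" by simp
    fix R :: real
    assume R: "R \<ge> 0"
    have "(1 + R) ^ m \<le> exp R ^ m"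
      using R exp_ge_add_one_self by (intro power_mono) auto
    also have "\<dots> = exp (m * R)" by (simp add: exp_of_nat_mult)
    finally have "(1 + R) ^ m * exp (\<phi> (a * R)) \<le> exp (m * R) * exp (\<phi> (a * R))" by simp
    also have "\<dots> = exp (m * R + \<phi> (a * R))" by (simp add: exp_add)
    also have "\<dots> \<le> exp ((m / a * \<bar>T\<bar> + K) + \<phi> (b * R))"
      using linear[OF R] K[of "a * R"] R ab by simp
    finally show "(1 + R) ^ m * exp (\<phi> (a * R)) \<le> exp (m / a * \<bar>T\<bar> + K) * exp (\<phi> (b * R))"
      by (simp only: exp_add)
  qed
qed

text \<open>
  This is the optimization over the radius. Passing to logarithms reduces it to the least upper
  bound property of the supremum defining the Young conjugate.
\<close>

lemma young_conj_exp_bound: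
  assumes "C > 0" and bound: "\<And>y. y > 0 \<Longrightarrow> A \<le> C * exp (- (x * y - \<psi> y))"
  shows "A \<le> C * exp (- young_conj \<psi> x)"
proof (cases "A > 0")
  case True
  have "young_conj \<psi> x \<le> ln (C / A)"
    unfolding young_conj_def
  proof (rule cSUP_least)
    fix y :: real
    assume "y \<in> {0<..}"
    then have "exp (x * y - \<psi> y) \<le> C / A"
      using bound[of y] True by (simp only: exp_minus) (simp add: field_simps)
    then show "x * y - \<psi> y \<le> ln (C / A)"
      using True \<open>C > 0\<close> by (simp add: ln_ge_iff)
  qed auto
  then have "exp (young_conj \<psi> x) \<le> C / A"
    using True \<open>C > 0\<close> by (simp add: ln_ge_iff)
  then show ?thesis
    using True by (simp add: exp_minus field_simps)
next
  case False
  moreover have "0 \<le> C * exp (- young_conj \<psi> x)" using \<open>C > 0\<close> by simp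
  ultimately show ?thesis by linarith
qed

theorem theorem1:
  fixes \<sigma> :: real and \<phi> :: "real \<Rightarrow> real" and f :: "complex \<Rightarrow> complex"
  assumes sigma_pos: "\<sigma> > 0"
    and phi_nonneg: "\<And>x. 0 \<le> x \<Longrightarrow> 0 \<le> \<phi> x"
    and phi_mono: "mono_on {0..} \<phi>"
    and phi_cont: "continuous_on {0..} \<phi>"
    and phi_superlinear: "filterlim (\<lambda>x. \<phi> x / x) at_top at_top"
    and phi_doubling: "\<And>h. h > 1 \<Longrightarrow> \<exists>K>0. \<forall>x\<ge>0. 2 * \<phi> x \<le> \<phi> (h * x) + K"
    and phi_convex: "convex_on {0..} (\<lambda>x. \<phi> (exp x))"
    and f_mem: "f \<in> S_space \<sigma> \<phi>"
  shows "\<forall>\<epsilon>>0. \<forall>m::nat. \<exists>c>0. \<forall>(n::nat) (x::real).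
           cmod (of_real x ^ m * (deriv ^^ n) f (of_real x))
             \<le> c * fact n * (\<sigma> + \<epsilon>) ^ n * exp (- young_conj (\<lambda>t. \<phi> (exp t)) (real n))"
proof (intro allI impI)
  fix \<epsilon> :: real and m :: nat
  assume eps: "\<epsilon> > 0"
  define a where "a = \<sigma> + \<epsilon> / 2"
  define b where "b = \<sigma> + \<epsilon>"
  have ab: "0 < a" "a < b" "0 < b"
    using sigma_pos eps by (auto simp: a_def b_def)
  have hol: "f holomorphic_on UNIV"
    using f_mem eps unfolding S_space_def S_space_step_def by blast
  obtain P where P: "P > 0"
    "\<And>z. cmod (f z) * (1 + cmod z) ^ m \<le> P * exp (\<phi> (a * \<bar>Im z\<bar>))"
    using S_space_weighted_bound[OF f_mem, of "\<epsilon> / 2" m] eps unfolding a_def by auto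
  obtain C where C: "C > 0"
    "\<And>R. 0 \<le> R \<Longrightarrow> (1 + R) ^ m * exp (\<phi> (a * R)) \<le> C * exp (\<phi> (b * R))"
    using superlinear_doubling_absorbs_power[OF phi_nonneg phi_superlinear phi_doubling ab(1,2)]
    by metis
  have strip: "cmod (f z) * (1 + cmod z) ^ m \<le> P * exp (\<phi> (a * R))" if "\<bar>Im z\<bar> \<le> R" for z R
  proof -
    have "\<phi> (a * \<bar>Im z\<bar>) \<le> \<phi> (a * R)"
      using that ab by (intro mono_onD[OF phi_mono]) auto
    then show ?thesis
      using P(1) by (intro order_trans[OF P(2)[of z]]) simp
  qed
  have "cmod (of_real x ^ m * (deriv ^^ n) f (of_real x))
          \<le> C * P * fact n * b ^ n * exp (- young_conj (\<lambda>t. \<phi> (exp t)) (real n))" for n x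
  proof (rule young_conj_exp_bound)
    show "C * P * fact n * b ^ n > 0" using C P ab by simp
    fix y :: real
    define R where "R = exp y / b"
    have R: "R > 0" "b * R = exp y" using ab by (auto simp: R_def)
    have "cmod (of_real x ^ m * (deriv ^^ n) f (of_real x))
            \<le> fact n * ((1 + R) ^ m * (P * exp (\<phi> (a * R)))) / R ^ n"
      by (rule weighted_Cauchy_estimate[OF hol R(1) strip])
    also have "\<dots> = fact n * P / R ^ n * ((1 + R) ^ m * exp (\<phi> (a * R)))"
      by simp
    also have "\<dots> \<le> fact n * P / R ^ n * (C * exp (\<phi> (b * R)))"
      using C(2)[of R] R P by (intro mult_left_mono) auto
    also have "\<dots> = C * P * fact n * b ^ n * (exp (\<phi> (exp y)) / exp y ^ n)"
      unfolding R(2) using ab by (simp add: R_def power_divide)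
    also have "exp (\<phi> (exp y)) / exp y ^ n = exp (- (real n * y - \<phi> (exp y)))"
      by (simp add: exp_diff exp_of_nat_mult)
    finally show "cmod (of_real x ^ m * (deriv ^^ n) f (of_real x))
        \<le> C * P * fact n * b ^ n * exp (- (real n * y - \<phi> (exp y)))" .
  qed
  then show "\<exists>c>0. \<forall>(n::nat) (x::real).
           cmod (of_real x ^ m * (deriv ^^ n) f (of_real x))
             \<le> c * fact n * (\<sigma> + \<epsilon>) ^ n * exp (- young_conj (\<lambda>t. \<phi> (exp t)) (real n))"
    using C(1) P(1) unfolding b_def by (intro exI[of _ "C * P"]) simp
qed

end
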